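(* Let $n\ge 1$ be an integer and let $V_{8n}=\langle a,b : a^{2n}=b^4=1,\ ba=a^{-1}b^{-1},\ b^{-1}a=a^{-1}b\rangle$. Then \[ \mathrm{CSCom}(V_{8n})\cong\begin{cases}K_4\vee(K_{4n-4}\sqcup 2K_{2n}), & \text{if } n \text{ is even},\\ K_2\vee(K_{4n-2}\sqcup 2K_{2n}), & \text{if } n \text{ is odd}.\end{cases} \]
   Context: For a finite group $G$, the conjugacy super commuting graph $\mathrm{CSCom}(G)$ is the simple graph with vertex set $G$ in which two distinct vertices $g,h$ are adjacent if and only if either $g$ and $h$ are conjugate in $G$, or there exist $g'$ in the conjugacy class of $g$ and $h'$ in the conjugacy class of $h$ with $g'h'=h'g'$. $K_r$ is the complete graph on $r$ vertices, $\sqcup$ is disjoint union of graphs, $mK_r$ is the disjoint union of $m$ copies of $K_r$, and $\vee$ is the join of graphs (disjoint union together with all edges between the two vertex sets). *)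

theory Defs
  imports "HOL-Algebra.Group" "Graph_Theory.Graph_Theory"
begin

section \<open>Groups given by generators and relations\<close>

text \<open>A letter \<open>(x, True)\<close> stands for the generator \<open>x\<close> and \<open>(x, False)\<close> for its formal inverse.\<close>

type_synonym 'a gword = "('a \<times> bool) list"

definition gen :: "'a \<Rightarrow> 'a gword" where
  "gen x = [(x, True)]"

definition inv_word :: "'a gword \<Rightarrow> 'a gword" where
  "inv_word w = rev (map (\<lambda>(x, e). (x, \<not> e)) w)"

definition word_pow :: "'a gword \<Rightarrow> nat \<Rightarrow> 'a gword" where
  "word_pow w k = concat (replicate k w)"

text \<open>
  A pair \<open>(u, v)\<close> in \<open>R\<close> is read as the relation \<open>u = v\<close>. The predicate below is the least
  congruence on words that contains free cancellation and all the relations, so its classes are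
  the elements of the free group modulo the normal closure of the elements \<open>u v\<^sup>-\<^sup>1\<close>.
\<close>

inductive word_eq :: "('a gword \<times> 'a gword) set \<Rightarrow> 'a gword \<Rightarrow> 'a gword \<Rightarrow> bool"
  for R :: "('a gword \<times> 'a gword) set" where
  refl: "word_eq R u u"
| sym: "word_eq R u v \<Longrightarrow> word_eq R v u"
| trans: "word_eq R u v \<Longrightarrow> word_eq R v w \<Longrightarrow> word_eq R u w"
| cong: "word_eq R u u' \<Longrightarrow> word_eq R v v' \<Longrightarrow> word_eq R (u @ v) (u' @ v')"
| cancel: "word_eq R [(x, e), (x, \<not> e)] []"
| rel: "(u, v) \<in> R \<Longrightarrow> word_eq R u v"

definition word_class :: "('a gword \<times> 'a gword) set \<Rightarrow> 'a gword \<Rightarrow> 'a gword set" where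
  "word_class R u = {v. word_eq R u v}"

text \<open>The generators are all the elements of the type \<open>'a\<close>.\<close>

definition presented_group :: "('a gword \<times> 'a gword) set \<Rightarrow> 'a gword set monoid" where
  "presented_group R =
     \<lparr>carrier = range (word_class R),
      monoid.mult = (\<lambda>X Y. {w. \<exists>u\<in>X. \<exists>v\<in>Y. word_eq R (u @ v) w}),
      one = word_class R []\<rparr>"

lemma word_class_eq_iff: "word_class R u = word_class R v \<longleftrightarrow> word_eq R u v"
  unfolding word_class_def
  by (auto intro: word_eq.refl word_eq.sym word_eq.trans)

lemma presented_group_simps:
  "carrier (presented_group R) = range (word_class R)"
  "\<one>\<^bsub>presented_group R\<^esub> = word_class R []"
  "word_class R u \<otimes>\<^bsub>presented_group R\<^esub> word_class R v = word_class R (u @ v)"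
  by (auto simp: presented_group_def word_class_def
      intro: word_eq.refl word_eq.sym word_eq.trans word_eq.cong)

lemma word_eq_inv_left: "word_eq R (inv_word w @ w) []"
proof (induction w)
  case Nil
  show ?case by (simp add: inv_word_def word_eq.refl)
next
  case (Cons p w)
  obtain x e where p: "p = (x, e)" by (cases p)
  have "word_eq R ([(x, \<not> e), (x, e)] @ w) ([] @ w)"
    using word_eq.cancel[of R x "\<not> e"] by (intro word_eq.cong) (auto intro: word_eq.refl)
  then have "word_eq R (inv_word w @ [(x, \<not> e), (x, e)] @ w) (inv_word w @ w)"
    by (intro word_eq.cong) (auto intro: word_eq.refl)
  then show ?case
    using Cons.IH by (auto simp: p inv_word_def intro: word_eq.trans)
qed

lemma group_presented_group: "group (presented_group R)"
proof (rule groupI)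
  fix X assume "X \<in> carrier (presented_group R)"
  then obtain w where w: "X = word_class R w" by (auto simp: presented_group_simps)
  have "word_class R (inv_word w) \<otimes>\<^bsub>presented_group R\<^esub> X = \<one>\<^bsub>presented_group R\<^esub>"
    by (simp add: w presented_group_simps word_class_eq_iff word_eq_inv_left)
  then show "\<exists>Y\<in>carrier (presented_group R). Y \<otimes>\<^bsub>presented_group R\<^esub> X = \<one>\<^bsub>presented_group R\<^esub>"
    by (auto simp: presented_group_simps(1))
qed (auto simp: presented_group_simps)

text \<open>
  Any choice of images of the generators in a group that satisfies the relations of \<open>R\<close> extends to
  a homomorphism (lemma \<open>presented_group_universal\<close>).
\<close>

definition eval_word :: "('g, 'm) monoid_scheme \<Rightarrow> ('a \<Rightarrow> 'g) \<Rightarrow> 'a gword \<Rightarrow> 'g" where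
  "eval_word H f w =
     foldr (\<lambda>(x, e) y. (if e then f x else inv\<^bsub>H\<^esub> (f x)) \<otimes>\<^bsub>H\<^esub> y) w \<one>\<^bsub>H\<^esub>"

lemma eval_word_closed:
  assumes "group H" "\<And>x. f x \<in> carrier H"
  shows "eval_word H f w \<in> carrier H"
proof -
  interpret H: group H by fact
  show ?thesis by (induction w) (auto simp: eval_word_def assms(2))
qed

lemma eval_word_append:
  assumes "group H" "\<And>x. f x \<in> carrier H"
  shows "eval_word H f (u @ v) = eval_word H f u \<otimes>\<^bsub>H\<^esub> eval_word H f v"
proof -
  interpret H: group H by fact
  note cl = eval_word_closed[of H f, OF assms]
  show ?thesis
  proof (induction u)
    case Nil
    show ?case using cl[of v] by (simp add: eval_word_def)
  next
    case (Cons p u)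
    then show ?case using cl[of u] cl[of v] assms(2)
      by (cases p) (auto simp: eval_word_def H.m_assoc)
  qed
qed

lemma eval_word_respects:
  assumes "group H" "\<And>x. f x \<in> carrier H"
    and "\<And>u v. (u, v) \<in> R \<Longrightarrow> eval_word H f u = eval_word H f v"
    and "word_eq R u v"
  shows "eval_word H f u = eval_word H f v"
proof -
  interpret H: group H by fact
  show ?thesis
    using assms(4)
  proof induction
    case (cancel x e)
    then show ?case using assms(2)[of x] by (cases e) (auto simp: eval_word_def)
  qed (auto simp: eval_word_append[OF assms(1,2)] assms(3))
qed

lemma presented_group_universal:
  assumes "group H" "\<And>x. f x \<in> carrier H"
    and "\<And>u v. (u, v) \<in> R \<Longrightarrow> eval_word H f u = eval_word H f v"
  shows "\<exists>h \<in> hom (presented_group R) H. \<forall>w. h (word_class R w) = eval_word H f w"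
proof -
  define h where "h X = eval_word H f (SOME w. X = word_class R w)" for X
  have h: "h (word_class R w) = eval_word H f w" for w
  proof -
    have "word_class R w = word_class R (SOME v. word_class R w = word_class R v)"
      by (rule someI[of _ w]) simp
    then have "word_eq R w (SOME v. word_class R w = word_class R v)"
      by (simp add: word_class_eq_iff)
    then show ?thesis
      unfolding h_def using eval_word_respects[of H f R, OF assms] by metis
  qed
  have "h \<in> hom (presented_group R) H"
    by (auto simp: hom_def presented_group_simps h eval_word_closed[OF assms(1,2)]
        eval_word_append[OF assms(1,2)])
  with h show ?thesis by blast
qed


section \<open>The group \<open>V\<^sub>8\<^sub>n\<close>\<close>

datatype v8_gen = Gen_a | Gen_b

definition V8_rels :: "nat \<Rightarrow> (v8_gen gword \<times> v8_gen gword) set" where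
  "V8_rels n =
     (let a = gen Gen_a; b = gen Gen_b in
      {(word_pow a (2 * n), []),
       (word_pow b 4, []),
       (b @ a, inv_word a @ inv_word b),
       (inv_word b @ a, inv_word a @ b)})"

definition V8 :: "nat \<Rightarrow> v8_gen gword set monoid" where
  "V8 n = presented_group (V8_rels n)"


section \<open>Graphs\<close>

text \<open>
  A simple graph is represented as a loop-free symmetric digraph without parallel arcs, an edge
  between \<open>u\<close> and \<open>v\<close> being the two arcs \<open>(u, v)\<close> and \<open>(v, u)\<close>
  (cf. the locale \<open>pair_graph\<close>).
\<close>

definition conj_class :: "('a, 'm) monoid_scheme \<Rightarrow> 'a \<Rightarrow> 'a set" where
  "conj_class G x = {g \<otimes>\<^bsub>G\<^esub> x \<otimes>\<^bsub>G\<^esub> inv\<^bsub>G\<^esub> g | g. g \<in> carrier G}"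

definition CSCom :: "('a, 'm) monoid_scheme \<Rightarrow> 'a pair_pre_digraph" where
  "CSCom G =
     \<lparr>pverts = carrier G,
      parcs = {(g, h). g \<in> carrier G \<and> h \<in> carrier G \<and> g \<noteq> h \<and>
        (h \<in> conj_class G g \<or>
         (\<exists>g'\<in>conj_class G g. \<exists>h'\<in>conj_class G h. g' \<otimes>\<^bsub>G\<^esub> h' = h' \<otimes>\<^bsub>G\<^esub> g'))}\<rparr>"

definition complete_graph :: "nat \<Rightarrow> nat pair_pre_digraph" where
  "complete_graph r = \<lparr>pverts = {..<r}, parcs = {(i, j). i < r \<and> j < r \<and> i \<noteq> j}\<rparr>"

definition disjoint_union ::
    "'a pair_pre_digraph \<Rightarrow> 'b pair_pre_digraph \<Rightarrow> ('a + 'b) pair_pre_digraph" where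
  "disjoint_union G H =
     \<lparr>pverts = pverts G <+> pverts H,
      parcs = {(Inl u, Inl v) | u v. (u, v) \<in> parcs G} \<union> {(Inr u, Inr v) | u v. (u, v) \<in> parcs H}\<rparr>"

definition graph_copies :: "nat \<Rightarrow> 'a pair_pre_digraph \<Rightarrow> (nat \<times> 'a) pair_pre_digraph" where
  "graph_copies m G =
     \<lparr>pverts = {..<m} \<times> pverts G,
      parcs = {((i, u), (i, v)) | i u v. i < m \<and> (u, v) \<in> parcs G}\<rparr>"

definition graph_join ::
    "'a pair_pre_digraph \<Rightarrow> 'b pair_pre_digraph \<Rightarrow> ('a + 'b) pair_pre_digraph" where
  "graph_join G H =
     \<lparr>pverts = pverts G <+> pverts H,
      parcs = parcs (disjoint_union G H)
        \<union> {(Inl u, Inr v) | u v. u \<in> pverts G \<and> v \<in> pverts H}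
        \<union> {(Inr v, Inl u) | u v. u \<in> pverts G \<and> v \<in> pverts H}\<rparr>"

lemma complete_digraph_complete_graph: "K\<^bsub>r\<^esub> (with_proj (complete_graph r))"
  by (auto simp: complete_digraph_pair_def complete_graph_def)

lemma pair_graph_graph_join:
  assumes "pair_graph G" "pair_graph H"
  shows "pair_graph (graph_join G H)"
proof -
  interpret G: pair_graph G by fact
  interpret H: pair_graph H by fact
  have "symmetric (with_proj (graph_join G H))"
    using G.sym_arcs H.sym_arcs
    by (auto simp: symmetric_def graph_join_def disjoint_union_def sym_def)
  moreover have "parcs (graph_join G H) \<subseteq> pverts (graph_join G H) \<times> pverts (graph_join G H)"
    by (auto simp: graph_join_def disjoint_union_def dest: G.in_arcsD1 G.in_arcsD2 H.in_arcsD1 H.in_arcsD2)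
  moreover have fin: "finite (pverts (graph_join G H))"
    by (simp add: graph_join_def)
  moreover have "fst e \<noteq> snd e" if "e \<in> parcs (graph_join G H)" for e
    using that G.pair_no_loops H.pair_no_loops by (force simp: graph_join_def disjoint_union_def)
  ultimately show ?thesis
    by unfold_locales (auto intro: finite_subset)
qed

end

theory Submission
  imports Defs "HOL-Algebra.Coset"
begin

text \<open>
  Put \<open>z = b\<^sup>2\<close>. The two mixed relations say that \<open>z\<close> is central and that
  \<open>b a b\<^sup>-\<^sup>1 = a\<^sup>-\<^sup>1 z\<close>. So every element is \<open>a\<^sup>i z\<^sup>k b\<^sup>e\<close> with \<open>i\<close> modulo \<open>2n\<close> and \<open>k, e\<close> modulo 2, and
  \<open>A = \<langle>a, z\<rangle>\<close> is an abelian subgroup of index 2. That these \<open>8n\<close> normal forms are distinct is shown by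
  multiplying them in a concrete group (\<open>V8_model\<close>) that satisfies the relations
  (\<open>V8_iso_model\<close>).

  In normal form everything is visible, and the description of adjacency does not depend on the
  parity of \<open>n\<close> (\<open>CSCom_V8_model_adjacent_iff\<close>):

  \<^item> The centre \<open>Z\<close> consists of the \<open>a\<^sup>i z\<^sup>k\<close> with \<open>i\<close> even and \<open>n dvd i\<close>. Its elements are adjacent to
    everything.

  \<^item> The elements of \<open>A - Z\<close> commute with each other and with nothing outside \<open>A\<close>. Since \<open>A\<close> and \<open>Z\<close>
    are normal, passing to conjugates changes nothing here.

  \<^item> Outside \<open>A\<close> the parity of the exponent \<open>i\<close> is a conjugacy invariant, because \<open>2n\<close> is even, and
    two commuting elements agree in it. Conversely, conjugation by \<open>a\<^sup>t\<close> adds \<open>2t\<close> to \<open>i\<close>, so an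
    element can be conjugated until it has any prescribed \<open>i\<close> of the same parity, and elements
    outside \<open>A\<close> with equal \<open>i\<close> commute. So adjacency is equality of parities.

  The parity of \<open>n\<close> enters only in the size of \<open>Z\<close>, which is 4 or 2 according to whether \<open>a\<^sup>n\<close> is
  central. The sets \<open>Z\<close>, \<open>A - Z\<close> and the two parity classes of size \<open>2n\<close> are the parts of the join
  (\<open>join_of_complete_graphs_characterization\<close>).
\<close>

section \<open>Isomorphisms of simple graphs\<close>

definition graph_bij :: "('a \<Rightarrow> 'b) \<Rightarrow> 'a pair_pre_digraph \<Rightarrow> 'b pair_pre_digraph \<Rightarrow> bool" where
  "graph_bij f G H \<longleftrightarrow> bij_betw f (pverts G) (pverts H) \<and>
     (\<forall>x\<in>pverts G. \<forall>y\<in>pverts G. (x, y) \<in> parcs G \<longleftrightarrow> (f x, f y) \<in> parcs H)"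

lemma graph_bij_comp:
  assumes "graph_bij f G H" "graph_bij g H K"
  shows "graph_bij (g \<circ> f) G K"
proof -
  have "f x \<in> pverts H" if "x \<in> pverts G" for x
    using assms(1) that by (auto simp: graph_bij_def dest: bij_betw_apply)
  with assms show ?thesis
    using bij_betw_trans[of f "pverts G" "pverts H" g] by (simp add: graph_bij_def)
qed

lemma digraph_iso_if_graph_bij:
  assumes f: "graph_bij f G H"
    and G: "parcs G \<subseteq> pverts G \<times> pverts G" and H: "parcs H \<subseteq> pverts H \<times> pverts H"
  shows "digraph_iso (with_proj G) (with_proj H)"
proof -
  let ?i = "\<lparr>iso_verts = f, iso_arcs = map_prod f f, iso_head = snd, iso_tail = fst\<rparr>"
  have inj: "inj_on f (pverts G)" and im: "f ` pverts G = pverts H"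
    using f by (auto simp: graph_bij_def bij_betw_def)
  have "wf_digraph (with_proj G)"
    using G by unfold_locales auto
  moreover have "inj_on (map_prod f f) (parcs G)"
    using map_prod_inj_on[OF inj inj] G by (rule inj_on_subset)
  ultimately have iso: "pre_digraph.digraph_isomorphism (with_proj G) ?i"
    using inj by (simp add: pre_digraph.digraph_isomorphism_def)
  have "map_prod f f ` parcs G = parcs H"
  proof
    show "map_prod f f ` parcs G \<subseteq> parcs H"
      using f G by (auto simp: graph_bij_def)
    show "parcs H \<subseteq> map_prod f f ` parcs G"
    proof (rule subrelI)
      fix u v assume uv: "(u, v) \<in> parcs H"
      then obtain x y where "x \<in> pverts G" "y \<in> pverts G" "u = f x" "v = f y"
        using H im by blast
      with uv f show "(u, v) \<in> map_prod f f ` parcs G"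
        by (force simp: graph_bij_def)
    qed
  qed
  then have "with_proj H = app_iso ?i (with_proj G)"
    using im by (simp add: app_iso_def with_proj_def)
  with iso show ?thesis
    unfolding digraph_iso_def by blast
qed

text \<open>
  The shape of the join leaves no choice but the sizes of its parts: any numbering of the elements of
  each part, with \<open>p\<close> naming the copy of \<open>K\<^sub>r\<close> to which an element outside \<open>A\<close> belongs, is an isomorphism.
\<close>

lemma join_of_complete_graphs_characterization:
  fixes G :: "'a pair_pre_digraph" and p :: "'a \<Rightarrow> nat"
  assumes fin: "finite (pverts G)" and ZA: "Z \<subseteq> A" "A \<subseteq> pverts G"
    and cZ: "card Z = s" and cA: "card (A - Z) = t"
    and p: "\<And>x. x \<in> pverts G - A \<Longrightarrow> p x < m"
    and cp: "\<And>i. i < m \<Longrightarrow> card {x \<in> pverts G - A. p x = i} = r"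
    and adj: "\<And>x y. x \<in> pverts G \<Longrightarrow> y \<in> pverts G \<Longrightarrow> (x, y) \<in> parcs G \<longleftrightarrow>
       x \<noteq> y \<and> (x \<in> Z \<or> y \<in> Z \<or> (x \<in> A \<and> y \<in> A) \<or> (x \<notin> A \<and> y \<notin> A \<and> p x = p y))"
  shows "\<exists>f. graph_bij f G (graph_join (complete_graph s)
     (disjoint_union (complete_graph t) (graph_copies m (complete_graph r))))"
proof -
  let ?V = "pverts G"
  let ?B = "\<lambda>i. {x \<in> ?V - A. p x = i}"
  have finA: "finite A" "finite Z"
    using fin ZA by (auto intro: finite_subset)
  obtain g where g: "bij_betw g Z {..<s}"
    using ex_bij_betw_finite_nat[of Z] finA cZ by (auto simp: atLeast0LessThan)
  obtain g' where g': "bij_betw g' (A - Z) {..<t}"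
    using ex_bij_betw_finite_nat[of "A - Z"] finA cA by (auto simp: atLeast0LessThan)
  have "\<exists>k. bij_betw k (?B i) {..<r}" if "i < m" for i
    using ex_bij_betw_finite_nat[of "?B i"] fin cp[OF that] by (auto simp: atLeast0LessThan)
  then obtain k where k: "\<And>i. i < m \<Longrightarrow> bij_betw (k i) (?B i) {..<r}"
    by metis
  define f where "f x = (if x \<in> Z then Inl (g x) else if x \<in> A then Inr (Inl (g' x))
     else Inr (Inr (p x, k (p x) x)))" for x
  let ?T = "graph_join (complete_graph s)
     (disjoint_union (complete_graph t) (graph_copies m (complete_graph r)))"
  have vT: "pverts ?T = {..<s} <+> ({..<t} <+> {..<m} \<times> {..<r})"
    by (simp add: graph_join_def disjoint_union_def graph_copies_def complete_graph_def)
  have kr: "k (p x) x < r" if "x \<in> ?V - A" for x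
    using bij_betw_apply[OF k[OF p[OF that]], of x] that by auto
  have gr: "g x < s" if "x \<in> Z" for x
    using bij_betw_apply[OF g that] by auto
  have gr': "g' x < t" if "x \<in> A" "x \<notin> Z" for x
    using bij_betw_apply[OF g', of x] that by auto
  have gi: "g x = g y \<longleftrightarrow> x = y" if "x \<in> Z" "y \<in> Z" for x y
    using g that by (auto simp: bij_betw_def dest: inj_onD)
  have gi': "g' x = g' y \<longleftrightarrow> x = y" if "x \<in> A" "x \<notin> Z" "y \<in> A" "y \<notin> Z" for x y
    using g' that by (auto simp: bij_betw_def dest: inj_onD)
  have ki: "k (p y) x = k (p y) y \<longleftrightarrow> x = y" if "x \<in> ?V - A" "y \<in> ?V - A" "p x = p y" for x y
    using k[OF p[OF that(2)]] that by (auto simp: bij_betw_def dest: inj_onD)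
  have inj: "inj_on f ?V"
    by (rule inj_onI) (auto simp: f_def gi gi' ki split: if_splits)
  have "f ` ?V = pverts ?T"
  proof
    show "f ` ?V \<subseteq> pverts ?T"
      unfolding vT using gr gr' kr p by (auto simp: f_def)
    have "Inl i \<in> f ` ?V" if "i < s" for i
    proof -
      have "i \<in> g ` Z"
        using g that by (simp add: bij_betw_def)
      then obtain x where "x \<in> Z" "g x = i" by blast
      then show ?thesis using ZA by (force simp: f_def)
    qed
    moreover have "Inr (Inl i) \<in> f ` ?V" if "i < t" for i
    proof -
      have "i \<in> g' ` (A - Z)"
        using g' that by (simp add: bij_betw_def)
      then obtain x where "x \<in> A - Z" "g' x = i" by blast
      then show ?thesis using ZA by (force simp: f_def)
    qed
    moreover have "Inr (Inr (i, j)) \<in> f ` ?V" if "i < m" "j < r" for i j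
    proof -
      have "j \<in> k i ` ?B i"
        using k[OF that(1)] that by (simp add: bij_betw_def)
      then obtain x where "x \<in> ?V - A" "p x = i" "k i x = j" by blast
      then show ?thesis using ZA by (force simp: f_def)
    qed
    ultimately show "pverts ?T \<subseteq> f ` ?V"
      unfolding vT by auto
  qed
  with inj have "bij_betw f ?V (pverts ?T)"
    by (simp add: bij_betw_def)
  moreover have "(x, y) \<in> parcs G \<longleftrightarrow> (f x, f y) \<in> parcs ?T" if "x \<in> ?V" "y \<in> ?V" for x y
    unfolding adj[OF that]
    using that ZA gr gr' kr p
    by (auto simp: f_def graph_join_def disjoint_union_def graph_copies_def complete_graph_def
        gi gi' ki)
  ultimately show ?thesis
    unfolding graph_bij_def by blast
qed


section \<open>Conjugacy super commuting graphs\<close>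

lemma parcs_CSCom_subset: "parcs (CSCom G) \<subseteq> pverts (CSCom G) \<times> pverts (CSCom G)"
  by (auto simp: CSCom_def)

lemma (in group) mem_conj_class_self:
  assumes "x \<in> carrier G"
  shows "x \<in> conj_class G x"
  unfolding conj_class_def using assms by (auto intro!: exI[of _ "\<one>"])

lemma (in group) conj_class_subset_carrier:
  "x \<in> carrier G \<Longrightarrow> conj_class G x \<subseteq> carrier G"
  by (auto simp: conj_class_def)

lemma conj_class_iso:
  assumes "group G" "group H" "h \<in> iso G H" "x \<in> carrier G"
  shows "conj_class H (h x) = h ` conj_class G x"
proof -
  interpret group_hom G H h
    using assms by (simp add: group_hom_def group_hom_axioms_def iso_def)
  have im: "carrier H = h ` carrier G"
    using assms(3) by (auto simp: iso_def bij_betw_def)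
  have "conj_class H (h x) = (\<lambda>g. h g \<otimes>\<^bsub>H\<^esub> h x \<otimes>\<^bsub>H\<^esub> inv\<^bsub>H\<^esub> h g) ` carrier G"
    unfolding conj_class_def im by blast
  also have "\<dots> = (\<lambda>g. h (g \<otimes>\<^bsub>G\<^esub> x \<otimes>\<^bsub>G\<^esub> inv\<^bsub>G\<^esub> g)) ` carrier G"
    using assms(4) by (intro image_cong) simp_all
  also have "\<dots> = h ` conj_class G x"
    unfolding conj_class_def by blast
  finally show ?thesis .
qed

text \<open>
  The graph is defined from multiplication alone, so it may be computed in any isomorphic copy of
  the group.
\<close>

lemma graph_bij_CSCom_iso:
  assumes "group G" "group H" "h \<in> iso G H"
  shows "graph_bij h (CSCom G) (CSCom H)"
proof -
  interpret group_hom G H h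
    using assms by (simp add: group_hom_def group_hom_axioms_def iso_def)
  have bij: "bij_betw h (carrier G) (carrier H)"
    using assms(3) by (simp add: iso_def)
  then have inj: "h x = h y \<longleftrightarrow> x = y" if "x \<in> carrier G" "y \<in> carrier G" for x y
    using that by (auto simp: bij_betw_def dest: inj_onD)
  have comm: "h x \<otimes>\<^bsub>H\<^esub> h y = h y \<otimes>\<^bsub>H\<^esub> h x \<longleftrightarrow> x \<otimes>\<^bsub>G\<^esub> y = y \<otimes>\<^bsub>G\<^esub> x"
    if "x \<in> carrier G" "y \<in> carrier G" for x y
    using that inj[of "x \<otimes>\<^bsub>G\<^esub> y" "y \<otimes>\<^bsub>G\<^esub> x"] by simp
  have "(x, y) \<in> parcs (CSCom G) \<longleftrightarrow> (h x, h y) \<in> parcs (CSCom H)"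
    if x: "x \<in> carrier G" and y: "y \<in> carrier G" for x y
  proof -
    note cx = G.conj_class_subset_carrier[OF x] and cy = G.conj_class_subset_carrier[OF y]
    have "h y \<in> h ` conj_class G x \<longleftrightarrow> y \<in> conj_class G x"
      using cx y inj by blast
    moreover have "(\<exists>g\<in>conj_class G x. \<exists>k\<in>conj_class G y. h g \<otimes>\<^bsub>H\<^esub> h k = h k \<otimes>\<^bsub>H\<^esub> h g) \<longleftrightarrow>
       (\<exists>g\<in>conj_class G x. \<exists>k\<in>conj_class G y. g \<otimes>\<^bsub>G\<^esub> k = k \<otimes>\<^bsub>G\<^esub> g)"
      using cx cy comm by blast
    ultimately show ?thesis
      using x y inj[OF x y] by (simp add: CSCom_def conj_class_iso[OF assms])
  qed
  with bij show ?thesis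
    by (simp add: graph_bij_def CSCom_def)
qed


section \<open>A concrete model\<close>

text \<open>
  The triple \<open>(i, k, e)\<close> stands for \<open>a\<^sup>i z\<^sup>k b\<^sup>e\<close> with \<open>z = b\<^sup>2\<close>; on exponents modulo 2, addition is \<open>\<noteq>\<close>.
  Moving \<open>b\<close> to the right past \<open>a\<^sup>j\<close> inverts \<open>a\<^sup>j\<close> and produces \<open>z\<^sup>j\<close>, and \<open>b b = z\<close>; so if \<open>e\<close>
  holds, these two effects together add \<open>odd j \<noteq> f\<close> to the exponent of \<open>z\<close>.
\<close>

definition V8_model :: "nat \<Rightarrow> (int \<times> bool \<times> bool) monoid" where
  "V8_model n =
     \<lparr>carrier = {0..<2 * int n} \<times> UNIV,
      monoid.mult = (\<lambda>(i, k, e) (j, l, f).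
        ((if e then i - j else i + j) mod (2 * int n), k \<noteq> (l \<noteq> (e \<and> (odd j \<noteq> f))), e \<noteq> f)),
      one = (0, False, False)\<rparr>"

lemma V8_model_simps:
  "x \<in> carrier (V8_model n) \<longleftrightarrow> fst x \<in> {0..<2 * int n}"
  "\<one>\<^bsub>V8_model n\<^esub> = (0, False, False)"
  "(i, k, e) \<otimes>\<^bsub>V8_model n\<^esub> (j, l, f) =
     ((if e then i - j else i + j) mod (2 * int n), k \<noteq> (l \<noteq> (e \<and> (odd j \<noteq> f))), e \<noteq> f)"
  by (cases x) (auto simp: V8_model_def)

text \<open>
  These two facts make the parity of the exponent of \<open>a\<close>, and its divisibility by \<open>n\<close>, well defined
  although the exponent only counts modulo \<open>2n\<close>.
\<close>

lemma even_mod_double: "even (i mod (2 * m)) \<longleftrightarrow> even (i :: int)"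
  by (rule dvd_mod_iff) simp

lemma dvd_mod_double: "m dvd i mod (2 * m) \<longleftrightarrow> m dvd (i :: int)"
  by (rule dvd_mod_iff) simp

lemma group_V8_model:
  assumes "n \<ge> 1"
  shows "group (V8_model n)"
proof (rule groupI)
  fix x y w :: "int \<times> bool \<times> bool"
  obtain i k e where x: "x = (i, k, e)" by (cases x)
  obtain j l f where y: "y = (j, l, f)" by (cases y)
  obtain u m g where w: "w = (u, m, g)" by (cases w)
  assume *: "x \<in> carrier (V8_model n)"
  show "\<one>\<^bsub>V8_model n\<^esub> \<otimes>\<^bsub>V8_model n\<^esub> x = x"
    using * by (simp add: x V8_model_simps)
  show "x \<otimes>\<^bsub>V8_model n\<^esub> y \<in> carrier (V8_model n)"
    using assms by (simp add: x y V8_model_simps)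
  show "x \<otimes>\<^bsub>V8_model n\<^esub> y \<otimes>\<^bsub>V8_model n\<^esub> w = x \<otimes>\<^bsub>V8_model n\<^esub> (y \<otimes>\<^bsub>V8_model n\<^esub> w)"
  proof -
    have "(if e \<noteq> f then (if e then i - j else i + j) mod (2 * int n) - u
        else (if e then i - j else i + j) mod (2 * int n) + u) mod (2 * int n) =
      (if e then i - (if f then j - u else j + u) mod (2 * int n)
        else i + (if f then j - u else j + u) mod (2 * int n)) mod (2 * int n)"
      by (cases e; cases f)
         (simp_all add: mod_simps add.assoc diff_diff_add diff_diff_eq2 diff_add_eq add_diff_eq)
    moreover have "even ((if f then j - u else j + u) mod (2 * int n)) \<longleftrightarrow> (even j \<longleftrightarrow> even u)"
      by (simp add: even_mod_double)
    ultimately show ?thesis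
      unfolding x y w V8_model_simps by simp blast
  qed
  let ?y = "if e then (i, k = odd i, True) else (- i mod (2 * int n), k, False)"
  have "?y \<in> carrier (V8_model n)" "?y \<otimes>\<^bsub>V8_model n\<^esub> x = \<one>\<^bsub>V8_model n\<^esub>"
    using * assms by (auto simp: x V8_model_simps mod_simps)
  then show "\<exists>y\<in>carrier (V8_model n). y \<otimes>\<^bsub>V8_model n\<^esub> x = \<one>\<^bsub>V8_model n\<^esub>"
    by blast
qed (use assms in \<open>auto simp: V8_model_simps\<close>)

lemma inv_V8_model:
  assumes "n \<ge> 1" "(i, k, e) \<in> carrier (V8_model n)"
  shows "inv\<^bsub>V8_model n\<^esub> (i, k, e) =
    (if e then (i, k = odd i, True) else (- i mod (2 * int n), k, False))" (is "_ = ?y")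
proof (rule group.inv_equality[OF group_V8_model[OF assms(1)] _ assms(2)])
  show "?y \<otimes>\<^bsub>V8_model n\<^esub> (i, k, e) = \<one>\<^bsub>V8_model n\<^esub>" "?y \<in> carrier (V8_model n)"
    using assms by (auto simp: V8_model_simps mod_simps)
qed

text \<open>
  Outside \<open>A\<close>, conjugation by \<open>a\<^sup>t\<close> shifts the exponent of \<open>a\<close> by \<open>2t\<close>, since \<open>a\<^sup>-\<^sup>t\<close> turns into \<open>a\<^sup>t\<close> when it
  passes \<open>b\<close>. Everywhere, conjugation by \<open>b\<close> negates that exponent. The invariants used below can
  be read off from this formula.
\<close>

lemma conj_V8_model:
  assumes "n \<ge> 1" "(t, l, f) \<in> carrier (V8_model n)" "(i, k, e) \<in> carrier (V8_model n)"
  shows "(t, l, f) \<otimes>\<^bsub>V8_model n\<^esub> (i, k, e) \<otimes>\<^bsub>V8_model n\<^esub> inv\<^bsub>V8_model n\<^esub> (t, l, f) =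
    ((if e then (if f then 2 * t - i else 2 * t + i) else (if f then - i else i)) mod (2 * int n),
     k \<noteq> ((f \<and> odd i) \<noteq> (e \<and> odd t)), e)"
  using assms
  by (cases e; cases f; simp add: inv_V8_model V8_model_simps mod_simps even_mod_double; blast)

text \<open>
  The conditions on \<open>i\<close> express \<open>a\<^sup>i = a\<^sup>-\<^sup>i z\<^sup>i\<close>, that is, that conjugation by \<open>b\<close> fixes \<open>a\<^sup>i z\<^sup>k\<close>.
\<close>

definition V8_center :: "nat \<Rightarrow> (int \<times> bool \<times> bool) set" where
  "V8_center n = {(i, k, e) \<in> carrier (V8_model n). \<not> e \<and> even i \<and> int n dvd i}"

lemma conj_class_V8_model_invariants:
  assumes "n \<ge> 1" "(i, k, e) \<in> carrier (V8_model n)"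
    and "(j, l, f) \<in> conj_class (V8_model n) (i, k, e)"
  shows "(j, l, f) \<in> carrier (V8_model n)" "f = e" "even j \<longleftrightarrow> even i"
    "(j, l, f) \<in> V8_center n \<longleftrightarrow> (i, k, e) \<in> V8_center n"
proof -
  show c: "(j, l, f) \<in> carrier (V8_model n)"
    using group.conj_class_subset_carrier[OF group_V8_model[OF assms(1)] assms(2)] assms(3) by blast
  obtain t u g where tug: "(t, u, g) \<in> carrier (V8_model n)"
    "(j, l, f) = (t, u, g) \<otimes>\<^bsub>V8_model n\<^esub> (i, k, e) \<otimes>\<^bsub>V8_model n\<^esub> inv\<^bsub>V8_model n\<^esub> (t, u, g)"
    using assms(3) unfolding conj_class_def by auto
  note eq = tug(2)[unfolded conj_V8_model[OF assms(1) tug(1) assms(2)]]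
  show "f = e" using eq by simp
  show "even j \<longleftrightarrow> even i"
    using eq by (auto simp: even_mod_double)
  then show "(j, l, f) \<in> V8_center n \<longleftrightarrow> (i, k, e) \<in> V8_center n"
    using eq c assms(2) by (auto simp: V8_center_def dvd_mod_double)
qed

text \<open>
  An element \<open>a\<^sup>i z\<^sup>k\<close> commutes with one outside \<open>A\<close> exactly if \<open>a\<^sup>i = a\<^sup>-\<^sup>i z\<^sup>i\<close>, which does not involve the
  other element and therefore says that \<open>a\<^sup>i z\<^sup>k\<close> is central. For two elements outside \<open>A\<close> the powers of
  \<open>z\<close> agree exactly if the two exponents of \<open>a\<close> have the same parity.
\<close>

lemma commute_V8_model_iff:
  assumes "(i, k, e) \<in> carrier (V8_model n)" "(j, l, f) \<in> carrier (V8_model n)"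
  shows "(i, k, e) \<otimes>\<^bsub>V8_model n\<^esub> (j, l, f) = (j, l, f) \<otimes>\<^bsub>V8_model n\<^esub> (i, k, e) \<longleftrightarrow>
    (i, k, e) \<in> V8_center n \<or> (j, l, f) \<in> V8_center n \<or> (\<not> e \<and> \<not> f) \<or>
    (e \<and> f \<and> (even i \<longleftrightarrow> even j) \<and> int n dvd i - j)"
proof -
  have *: "a mod (2 * int n) = b mod (2 * int n) \<longleftrightarrow> int n dvd c" if "a - b = 2 * c \<or> b - a = 2 * c"
    for a b c
    using that by (metis mod_eq_dvd_iff dvd_mult_cancel_left zero_neq_numeral)
  have "(j + i) mod (2 * int n) = (j - i) mod (2 * int n) \<longleftrightarrow> int n dvd i"
    "(i - j) mod (2 * int n) = (j + i) mod (2 * int n) \<longleftrightarrow> int n dvd j"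
    "(i - j) mod (2 * int n) = (j - i) mod (2 * int n) \<longleftrightarrow> int n dvd i - j"
    by (intro *; simp)+
  then show ?thesis
    using assms by (cases e; cases f) (auto simp: V8_model_simps V8_center_def add.commute)
qed

text \<open>
  From left to right, the disjunction on the right depends only on the two conjugacy classes, and it
  holds both for conjugate and for commuting elements. From right to left, the two elements commute
  themselves unless both lie outside \<open>A\<close> with exponents \<open>i\<close> and \<open>j\<close> of equal parity; in that case the
  first is replaced by a conjugate whose exponent is \<open>j\<close>.
\<close>

lemma CSCom_V8_model_adjacent_iff:
  assumes n: "n \<ge> 1"
    and x: "(i, k, e) \<in> carrier (V8_model n)" and y: "(j, l, f) \<in> carrier (V8_model n)"
  shows "((i, k, e), (j, l, f)) \<in> parcs (CSCom (V8_model n)) \<longleftrightarrow> (i, k, e) \<noteq> (j, l, f) \<and>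
    ((i, k, e) \<in> V8_center n \<or> (j, l, f) \<in> V8_center n \<or> (\<not> e \<and> \<not> f) \<or>
     (e \<and> f \<and> (even i \<longleftrightarrow> even j)))"
    (is "?adj \<longleftrightarrow> ?ne \<and> ?R")
proof -
  let ?G = "V8_model n"
  interpret group ?G by (rule group_V8_model[OF n])
  let ?C = "\<exists>g'\<in>conj_class ?G (i, k, e). \<exists>h'\<in>conj_class ?G (j, l, f).
    g' \<otimes>\<^bsub>?G\<^esub> h' = h' \<otimes>\<^bsub>?G\<^esub> g'"
  have adj: "?adj \<longleftrightarrow> ?ne \<and> ((j, l, f) \<in> conj_class ?G (i, k, e) \<or> ?C)"
    using x y by (simp add: CSCom_def)
  have "?R" if "(j, l, f) \<in> conj_class ?G (i, k, e)"
    using conj_class_V8_model_invariants[OF n x that] by auto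
  moreover have "?R" if C: "?C"
  proof -
    obtain i' k' e' j' l' f' where
      x': "(i', k', e') \<in> conj_class ?G (i, k, e)" and y': "(j', l', f') \<in> conj_class ?G (j, l, f)"
      and "(i', k', e') \<otimes>\<^bsub>?G\<^esub> (j', l', f') = (j', l', f') \<otimes>\<^bsub>?G\<^esub> (i', k', e')"
      using C by auto
    then show ?thesis
      using conj_class_V8_model_invariants[OF n x x'] conj_class_V8_model_invariants[OF n y y']
      by (simp add: commute_V8_model_iff) blast
  qed
  moreover have "?C" if "?R"
  proof (cases "e \<and> f \<and> (even i \<longleftrightarrow> even j)")
    case False
    with that have "(i, k, e) \<otimes>\<^bsub>?G\<^esub> (j, l, f) = (j, l, f) \<otimes>\<^bsub>?G\<^esub> (i, k, e)"
      using x y by (simp add: commute_V8_model_iff) blast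
    then show ?thesis
      using mem_conj_class_self x y by blast
  next
    case True
    \<comment> \<open>Conjugation by \<open>a\<^sup>d\<close> adds \<open>2d = j - i\<close> to the exponent \<open>i\<close>.\<close>
    define d where "d = (j - i) div 2"
    have "j = 2 * d + i"
      using True by (simp add: d_def)
    then have "(2 * (d mod (2 * int n)) + i) mod (2 * int n) = j mod (2 * int n)"
      by (metis mod_add_left_eq mod_mult_right_eq)
    then have j: "(2 * (d mod (2 * int n)) + i) mod (2 * int n) = j"
      using y by (simp add: V8_model_simps)
    have t: "(d mod (2 * int n), False, False) \<in> carrier ?G"
      using n by (simp add: V8_model_simps)
    have "(d mod (2 * int n), False, False) \<otimes>\<^bsub>?G\<^esub> (i, k, e) \<otimes>\<^bsub>?G\<^esub>
        inv\<^bsub>?G\<^esub> (d mod (2 * int n), False, False) = (j, k \<noteq> odd d, True)"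
      using conj_V8_model[OF n t x] True j by (simp add: even_mod_double)
    then have "(j, k \<noteq> odd d, True) \<in> conj_class ?G (i, k, e)"
      unfolding conj_class_def mem_Collect_eq using t by metis
    moreover have "(j, k \<noteq> odd d, True) \<otimes>\<^bsub>?G\<^esub> (j, l, f) = (j, l, f) \<otimes>\<^bsub>?G\<^esub> (j, k \<noteq> odd d, True)"
      using y True by (subst commute_V8_model_iff) (auto simp: V8_model_simps)
    ultimately show ?thesis
      using mem_conj_class_self[OF y] by blast
  qed
  ultimately show ?thesis
    unfolding adj by blast
qed

lemma card_V8_center:
  assumes "n \<ge> 1"
  shows "card (V8_center n) = (if even n then 4 else 2)"
proof -
  \<comment> \<open>Only \<open>i = 0\<close> and \<open>i = n\<close> qualify, and \<open>i = n\<close> is excluded by evenness when \<open>n\<close> is odd.\<close>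
  have multiples: "i = 0 \<or> i = int n" if i: "int n dvd i" "0 \<le> i" "i < 2 * int n" for i
  proof -
    obtain c where c: "i = int n * c" using i(1) by (rule dvdE)
    have "0 \<le> c" "c < 2"
      using i assms by (simp_all add: c zero_le_mult_iff)
    then have "c = 0 \<or> c = 1" by linarith
    then show ?thesis
      using c by auto
  qed
  have "(i, k, e) \<in> V8_center n \<longleftrightarrow> (i = 0 \<or> even n \<and> i = int n) \<and> \<not> e" for i k e
    using assms multiples[of i] unfolding V8_center_def by (auto simp: V8_model_simps)
  then have "V8_center n = (if even n then {0, int n} else {0}) \<times> UNIV \<times> {False}"
    by auto
  then show ?thesis
    using assms by (simp add: card_cartesian_product)
qed

lemma card_parity_class:
  assumes "p < 2"
  shows "card {x \<in> carrier (V8_model n). snd (snd x) \<and> (if even (fst x) then 0 else 1) = (p::nat)} = 2 * n"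
    (is "card ?S = _")
proof -
  let ?g = "\<lambda>(c, k). (2 * c + int p, k :: bool, True)"
  have S: "(i, k, e) \<in> ?S \<longleftrightarrow> (\<exists>c. 0 \<le> c \<and> c < int n \<and> i = 2 * c + int p) \<and> e" for i k e
  proof -
    have parity: "(if even i then 0 else 1) = p \<longleftrightarrow> i mod 2 = int p"
    proof (cases "even i")
      case True
      then have "i mod 2 = 0" by presburger
      with True show ?thesis by simp
    next
      case False
      then have "i mod 2 = 1" by presburger
      with False show ?thesis by auto
    qed
    have "0 \<le> i \<and> i < 2 * int n \<and> i mod 2 = int p \<longleftrightarrow>
        (\<exists>c. 0 \<le> c \<and> c < int n \<and> i = 2 * c + int p)"
    proof
      assume i: "0 \<le> i \<and> i < 2 * int n \<and> i mod 2 = int p"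
      then have "i = 2 * (i div 2) + int p"
        using mult_div_mod_eq[of 2 i] by simp
      with i assms have "0 \<le> i div 2 \<and> i div 2 < int n \<and> i = 2 * (i div 2) + int p"
        by linarith
      then show "\<exists>c. 0 \<le> c \<and> c < int n \<and> i = 2 * c + int p" ..
    next
      assume "\<exists>c. 0 \<le> c \<and> c < int n \<and> i = 2 * c + int p"
      then show "0 \<le> i \<and> i < 2 * int n \<and> i mod 2 = int p"
        using assms by auto
    qed
    with parity show ?thesis
      by (simp add: V8_model_simps) blast
  qed
  have "inj_on ?g ({0..<int n} \<times> UNIV)"
    by (auto simp: inj_on_def)
  moreover have "?g ` ({0..<int n} \<times> UNIV) = ?S"
  proof (rule Set.set_eqI)
    fix x :: "int \<times> bool \<times> bool"
    obtain i k e where x: "x = (i, k, e)" by (cases x)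
    show "x \<in> ?g ` ({0..<int n} \<times> UNIV) \<longleftrightarrow> x \<in> ?S"
      unfolding x S by (auto simp: image_iff)
  qed
  ultimately have "bij_betw ?g ({0..<int n} \<times> UNIV) ?S"
    by (simp only: bij_betw_def)
  then have "card ({0..<int n} \<times> (UNIV :: bool set)) = card ?S"
    by (rule bij_betw_same_card)
  moreover have "card ({0..<int n} \<times> (UNIV :: bool set)) = 2 * n"
    by (simp add: card_cartesian_product)
  ultimately show ?thesis
    by simp
qed

lemma CSCom_V8_model_structure:
  assumes n: "n \<ge> 1"
  shows "\<exists>f. graph_bij f (CSCom (V8_model n))
    (graph_join (complete_graph (if even n then 4 else 2))
      (disjoint_union (complete_graph (4 * n - (if even n then 4 else 2)))
        (graph_copies 2 (complete_graph (2 * n)))))"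
proof (rule join_of_complete_graphs_characterization)
  let ?A = "{x \<in> carrier (V8_model n). \<not> snd (snd x)}"
  let ?p = "\<lambda>x. if even (fst x) then 0 else 1 :: nat"
  have V: "pverts (CSCom (V8_model n)) = carrier (V8_model n)"
    by (simp add: CSCom_def)
  show "finite (pverts (CSCom (V8_model n)))"
    unfolding V by (simp add: V8_model_def)
  then have fin: "finite ?A"
    by (simp add: V)
  show ZA: "V8_center n \<subseteq> ?A"
    by (auto simp: V8_center_def)
  show "?A \<subseteq> pverts (CSCom (V8_model n))"
    by (auto simp: V)
  show "card (V8_center n) = (if even n then 4 else 2)"
    by (rule card_V8_center[OF n])
  have "?A = {0..<2 * int n} \<times> UNIV \<times> {False}"
    by (auto simp: V8_model_def)
  then have "card ?A = 4 * n"
    by (simp add: card_cartesian_product)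
  then show "card (?A - V8_center n) = 4 * n - (if even n then 4 else 2)"
    using card_Diff_subset[OF finite_subset[OF ZA fin] ZA] card_V8_center[OF n] by simp
  show "?p x < 2" for x :: "int \<times> bool \<times> bool"
    by simp
  show "card {x \<in> pverts (CSCom (V8_model n)) - ?A. ?p x = i} = 2 * n" if "i < 2" for i
  proof -
    have "{x \<in> pverts (CSCom (V8_model n)) - ?A. ?p x = i} =
      {x \<in> carrier (V8_model n). snd (snd x) \<and> ?p x = i}"
      by (auto simp: V)
    then show ?thesis
      using card_parity_class[OF that] by simp
  qed
  show "(x, y) \<in> parcs (CSCom (V8_model n)) \<longleftrightarrow> x \<noteq> y \<and>
     (x \<in> V8_center n \<or> y \<in> V8_center n \<or> (x \<in> ?A \<and> y \<in> ?A) \<or> (x \<notin> ?A \<and> y \<notin> ?A \<and> ?p x = ?p y))"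
    if "x \<in> pverts (CSCom (V8_model n))" "y \<in> pverts (CSCom (V8_model n))" for x y
  proof -
    obtain i k e where x: "x = (i, k, e)" by (cases x)
    obtain j l f where y: "y = (j, l, f)" by (cases y)
    have "(i, k, e) \<in> carrier (V8_model n)" "(j, l, f) \<in> carrier (V8_model n)"
      using that by (simp_all add: V x y)
    then show ?thesis
      unfolding x y CSCom_V8_model_adjacent_iff[OF n \<open>(i, k, e) \<in> _\<close> \<open>(j, l, f) \<in> _\<close>]
      by simp
  qed
qed


section \<open>The presented group and the model\<close>

text \<open>
  The rewriting rule that collects the powers of \<open>a\<close> on the left. With \<open>c = a\<^sup>-\<^sup>1\<close> and \<open>z = b\<^sup>2\<close>, the first
  mixed relation becomes \<open>b a = c z b\<close> because \<open>b\<^sup>-\<^sup>1 = z b\<close>. The second one gives \<open>b c = a b\<^sup>-\<^sup>1\<close>, hence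
  \<open>b\<^sup>2 a = b c b\<^sup>-\<^sup>1 = a b\<^sup>-\<^sup>2 = a b\<^sup>2\<close>, so that \<open>z\<close> commutes with \<open>a\<close>. Therefore \<open>b a\<^sup>i = (c z)\<^sup>i b = c\<^sup>i z\<^sup>i b\<close>. The inverse \<open>c\<close>
  is written as \<open>a\<^sup>2\<^sup>n\<^sup>-\<^sup>1\<close> so that all exponents are natural numbers.
\<close>

lemma (in group) V8_normal_form_step:
  assumes a: "a \<in> carrier G" and b: "b \<in> carrier G"
    and a2n: "a [^] (2 * n) = \<one>" and n: "n \<ge> 1" and b4: "b [^] (4::nat) = \<one>"
    and r1: "b \<otimes> a = inv a \<otimes> inv b" and r2: "inv b \<otimes> a = inv a \<otimes> b"
  shows "b \<otimes> (a [^] (i::nat) \<otimes> b [^] (j::nat)) =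
    a [^] ((2 * n - 1) * i) \<otimes> b [^] (2 * i + 1 + j)"
proof -
  define z where "z = b [^] (2::nat)"
  define c where "c = inv a"
  have cl: "z \<in> carrier G" "c \<in> carrier G"
    using a b by (auto simp: z_def c_def)
  have c: "c = a [^] (2 * n - 1)"
  proof -
    have "a [^] (2 * n - 1) \<otimes> a = a [^] Suc (2 * n - 1)" by simp
    also have "Suc (2 * n - 1) = 2 * n" using n by simp
    finally have "a [^] (2 * n - 1) \<otimes> a = \<one>" using a2n by simp
    then show ?thesis
      unfolding c_def using a by (intro inv_equality) auto
  qed
  have invb: "inv b = z \<otimes> b"
  proof (rule inv_equality[OF _ b])
    have "z \<otimes> b \<otimes> b = z \<otimes> b [^] (2::nat)"
      using b cl by (simp add: m_assoc numeral_2_eq_2)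
    also have "\<dots> = b [^] (4::nat)"
      using b by (simp add: z_def nat_pow_mult)
    finally show "z \<otimes> b \<otimes> b = \<one>" using b4 by simp
  qed (use b cl in auto)
  have zb: "z \<otimes> b = b \<otimes> z"
    using b by (simp add: z_def pow_mult_distrib nat_pow_comm flip: nat_pow_Suc nat_pow_Suc2)
  have ba: "b \<otimes> a = c \<otimes> z \<otimes> b"
    using r1 invb a b cl by (simp add: c_def m_assoc)
  have bc: "b \<otimes> c = a \<otimes> inv b"
  proof -
    have "b \<otimes> c = b \<otimes> (c \<otimes> b) \<otimes> inv b"
      using a b cl by (simp add: m_assoc)
    also have "c \<otimes> b = inv b \<otimes> a"
      using r2 by (simp add: c_def)
    also have "b \<otimes> (inv b \<otimes> a) = a"
      using a b by (simp flip: m_assoc)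
    finally show ?thesis .
  qed
  have za: "z \<otimes> a = a \<otimes> z"
  proof -
    have "z \<otimes> a = b \<otimes> (b \<otimes> a)"
      using a b by (simp add: z_def numeral_2_eq_2 m_assoc)
    also have "\<dots> = b \<otimes> c \<otimes> inv b"
      using a b cl r1 by (simp add: c_def m_assoc)
    also have "\<dots> = a \<otimes> (inv b \<otimes> inv b)"
      using a b cl by (simp add: bc m_assoc)
    also have "inv b \<otimes> inv b = z"
    proof -
      have "inv b \<otimes> inv b = inv z"
        using b by (simp add: z_def numeral_2_eq_2 inv_mult_group)
      also have "\<dots> = z"
        using b b4 by (intro inv_equality) (auto simp: z_def nat_pow_mult)
      finally show ?thesis .
    qed
    finally show ?thesis .
  qed
  have zc: "z \<otimes> c = c \<otimes> z"
    using a cl za by (metis c group_commutes_pow)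
  have "b \<otimes> a [^] i = (c \<otimes> z) [^] i \<otimes> b"
  proof (induction i)
    case (Suc i)
    have "b \<otimes> a [^] Suc i = (c \<otimes> z) [^] i \<otimes> b \<otimes> a"
      using a b cl Suc by (simp flip: m_assoc)
    also have "\<dots> = (c \<otimes> z) [^] i \<otimes> (c \<otimes> z) \<otimes> b"
      using a b cl ba by (simp add: m_assoc)
    finally show ?case by simp
  qed (use b in simp)
  also have "(c \<otimes> z) [^] i = c [^] i \<otimes> z [^] i"
    using cl zc by (simp add: pow_mult_distrib)
  also have "c [^] i = a [^] ((2 * n - 1) * i)"
    using a by (simp add: c nat_pow_pow)
  also have "z [^] i = b [^] (2 * i)"
    using b by (simp add: z_def nat_pow_pow)
  finally have "b \<otimes> a [^] i \<otimes> b [^] j = a [^] ((2 * n - 1) * i) \<otimes> (b [^] (2 * i) \<otimes> b \<otimes> b [^] j)"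
    using a b by (simp add: m_assoc)
  moreover have "b [^] (2 * i) \<otimes> b \<otimes> b [^] j = b [^] (2 * i + 1 + j)"
    using b nat_pow_mult[of b "Suc (2 * i)" j] by simp
  ultimately show ?thesis
    using a b by (simp add: m_assoc)
qed

lemma eval_word_pow:
  assumes "group H" "\<And>x. f x \<in> carrier H"
  shows "eval_word H f (word_pow w k) = eval_word H f w [^]\<^bsub>H\<^esub> k"
proof -
  interpret group H by fact
  show ?thesis
  proof (induction k)
    case (Suc k)
    have "word_pow w (Suc k) = w @ word_pow w k"
      by (simp add: word_pow_def)
    with Suc show ?case
      using eval_word_closed[of H f, OF assms] nat_pow_Suc2[of "eval_word H f w" k]
      by (simp add: eval_word_append[OF assms])
  qed (simp add: word_pow_def eval_word_def)
qed

lemma presented_group_pow: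
  "word_class R w [^]\<^bsub>presented_group R\<^esub> k = word_class R (word_pow w k)"
proof -
  interpret group "presented_group R" by (rule group_presented_group)
  have "word_class R w \<in> carrier (presented_group R)"
    by (simp add: presented_group_simps)
  then show ?thesis
  proof (induction k)
    case (Suc k)
    then show ?case
      using nat_pow_Suc2[of "word_class R w" k]
      by (simp add: presented_group_simps word_pow_def)
  qed (simp add: presented_group_simps word_pow_def)
qed

lemma presented_group_inv:
  "inv\<^bsub>presented_group R\<^esub> (word_class R w) = word_class R (inv_word w)"
  by (rule group.inv_equality[OF group_presented_group])
     (auto simp: presented_group_simps word_class_eq_iff word_eq_inv_left)

text \<open>
  The set of all \<open>a\<^sup>i b\<^sup>j\<close> contains the identity and is closed under left multiplication by \<open>a\<close> and \<open>b\<close>.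
  As the generators have finite order, their inverses are powers of them, so the set is also closed
  under the inverse letters and contains the class of every word.
\<close>

lemma V8_normal_form:
  assumes n: "n \<ge> 1"
  defines "a \<equiv> word_class (V8_rels n) (gen Gen_a)" and "b \<equiv> word_class (V8_rels n) (gen Gen_b)"
  shows "a [^]\<^bsub>V8 n\<^esub> (2 * n) = \<one>\<^bsub>V8 n\<^esub>" "b [^]\<^bsub>V8 n\<^esub> (4::nat) = \<one>\<^bsub>V8 n\<^esub>"
    and "X \<in> carrier (V8 n) \<Longrightarrow> \<exists>(i::nat) (j::nat). X = a [^]\<^bsub>V8 n\<^esub> i \<otimes>\<^bsub>V8 n\<^esub> b [^]\<^bsub>V8 n\<^esub> j"
proof -
  let ?R = "V8_rels n"
  interpret group "V8 n" unfolding V8_def by (rule group_presented_group)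
  note simps = presented_group_simps[of ?R, folded V8_def]
    presented_group_pow[of ?R, folded V8_def] presented_group_inv[of ?R, folded V8_def]
  have a: "a \<in> carrier (V8 n)" and b: "b \<in> carrier (V8 n)"
    by (auto simp: a_def b_def simps)
  have rels: "(word_pow (gen Gen_a) (2 * n), []) \<in> ?R" "(word_pow (gen Gen_b) 4, []) \<in> ?R"
    "(gen Gen_b @ gen Gen_a, inv_word (gen Gen_a) @ inv_word (gen Gen_b)) \<in> ?R"
    "(inv_word (gen Gen_b) @ gen Gen_a, inv_word (gen Gen_a) @ gen Gen_b) \<in> ?R"
    by (simp_all add: V8_rels_def Let_def)
  show a2n: "a [^]\<^bsub>V8 n\<^esub> (2 * n) = \<one>\<^bsub>V8 n\<^esub>" and b4: "b [^]\<^bsub>V8 n\<^esub> (4::nat) = \<one>\<^bsub>V8 n\<^esub>"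
    using rels by (auto simp: a_def b_def simps word_class_eq_iff intro: word_eq.rel)
  have r: "b \<otimes>\<^bsub>V8 n\<^esub> a = inv\<^bsub>V8 n\<^esub> a \<otimes>\<^bsub>V8 n\<^esub> inv\<^bsub>V8 n\<^esub> b"
    "inv\<^bsub>V8 n\<^esub> b \<otimes>\<^bsub>V8 n\<^esub> a = inv\<^bsub>V8 n\<^esub> a \<otimes>\<^bsub>V8 n\<^esub> b"
    using rels by (auto simp: a_def b_def simps word_class_eq_iff intro: word_eq.rel)
  define N where "N = {a [^]\<^bsub>V8 n\<^esub> (i::nat) \<otimes>\<^bsub>V8 n\<^esub> b [^]\<^bsub>V8 n\<^esub> (j::nat) | i j. True}"
  have aN: "a \<otimes>\<^bsub>V8 n\<^esub> X \<in> N" if "X \<in> N" for X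
  proof -
    obtain i j :: nat where X: "X = a [^]\<^bsub>V8 n\<^esub> i \<otimes>\<^bsub>V8 n\<^esub> b [^]\<^bsub>V8 n\<^esub> j"
      using \<open>X \<in> N\<close> by (auto simp: N_def)
    have "a \<otimes>\<^bsub>V8 n\<^esub> X = a [^]\<^bsub>V8 n\<^esub> Suc i \<otimes>\<^bsub>V8 n\<^esub> b [^]\<^bsub>V8 n\<^esub> j"
      using a b nat_pow_Suc2[OF a, of i] by (simp add: X m_assoc)
    then show ?thesis unfolding N_def by blast
  qed
  have bN: "b \<otimes>\<^bsub>V8 n\<^esub> X \<in> N" if "X \<in> N" for X
  proof -
    obtain i j :: nat where X: "X = a [^]\<^bsub>V8 n\<^esub> i \<otimes>\<^bsub>V8 n\<^esub> b [^]\<^bsub>V8 n\<^esub> j"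
      using \<open>X \<in> N\<close> by (auto simp: N_def)
    show ?thesis
      unfolding X V8_normal_form_step[OF a b a2n n b4 r] N_def by blast
  qed
  have NG: "N \<subseteq> carrier (V8 n)"
    using a b by (auto simp: N_def)
  have pow: "g [^]\<^bsub>V8 n\<^esub> (k::nat) \<otimes>\<^bsub>V8 n\<^esub> X \<in> N"
    if g: "g \<in> carrier (V8 n)" "\<And>X. X \<in> N \<Longrightarrow> g \<otimes>\<^bsub>V8 n\<^esub> X \<in> N" and X: "X \<in> N" for g k X
    using X
  proof (induction k arbitrary: X)
    case (Suc k)
    then show ?case
      using g NG by (simp add: m_assoc subset_iff)
  qed (use NG in auto)
  have inv_pow: "inv\<^bsub>V8 n\<^esub> g = g [^]\<^bsub>V8 n\<^esub> (k - 1)"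
    if "g \<in> carrier (V8 n)" "g [^]\<^bsub>V8 n\<^esub> k = \<one>\<^bsub>V8 n\<^esub>" "k \<ge> 1" for g and k :: nat
    using that by (intro inv_equality) (auto simp: Suc_le_eq simp flip: nat_pow_Suc)
  have "word_class ?R w \<in> N" for w
  proof (induction w)
    case Nil
    have "\<one>\<^bsub>V8 n\<^esub> = a [^]\<^bsub>V8 n\<^esub> (0::nat) \<otimes>\<^bsub>V8 n\<^esub> b [^]\<^bsub>V8 n\<^esub> (0::nat)"
      by simp
    then show ?case unfolding simps(2)[symmetric] N_def by blast
  next
    case (Cons q w)
    obtain x e where q: "q = (x, e)" by (cases q)
    let ?g = "word_class ?R (gen x)"
    have g: "?g \<in> carrier (V8 n)"
      by (simp add: simps)
    have gN: "?g \<otimes>\<^bsub>V8 n\<^esub> X \<in> N" if "X \<in> N" for X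
      using aN bN that by (cases x) (auto simp: a_def b_def)
    have "word_class ?R (q # w) = word_class ?R [q] \<otimes>\<^bsub>V8 n\<^esub> word_class ?R w"
      by (simp add: simps)
    also have "\<dots> \<in> N"
    proof (cases e)
      case True
      then show ?thesis
        using gN[OF Cons.IH] by (simp add: q gen_def)
    next
      case False
      then have "word_class ?R [q] = inv\<^bsub>V8 n\<^esub> ?g"
        by (simp add: q gen_def inv_word_def simps)
      moreover have "\<exists>k::nat. inv\<^bsub>V8 n\<^esub> ?g = ?g [^]\<^bsub>V8 n\<^esub> k"
        using inv_pow[OF a a2n] inv_pow[OF b b4] n by (cases x) (auto simp: a_def b_def)
      ultimately show ?thesis
        using pow[OF g gN Cons.IH] by auto
    qed
    finally show ?case .
  qed
  then show "\<exists>(i::nat) (j::nat). X = a [^]\<^bsub>V8 n\<^esub> i \<otimes>\<^bsub>V8 n\<^esub> b [^]\<^bsub>V8 n\<^esub> j" if "X \<in> carrier (V8 n)"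
    using that by (auto simp: simps N_def)
qed

lemma V8_model_pow_a:
  "n \<ge> 1 \<Longrightarrow> (1, False, False) [^]\<^bsub>V8_model n\<^esub> (i::nat) = (int i mod (2 * int n), False, False)"
  by (induction i) (auto simp: V8_model_simps nat_pow_def mod_simps add.commute)

lemma V8_model_pow_b:
  "n \<ge> 1 \<Longrightarrow> (0, False, True) [^]\<^bsub>V8_model n\<^esub> (j::nat) = (0, odd (j div 2), odd j)"
  by (induction j) (auto simp: V8_model_simps nat_pow_def)

text \<open>
  The universal property gives a homomorphism onto the model. It maps \<open>a\<^sup>i b\<^sup>j\<close> to a triple that
  determines \<open>i\<close> modulo \<open>2n\<close> and \<open>j\<close> modulo 4. So if \<open>a\<^sup>i b\<^sup>j\<close> is in the kernel, then the relations
  \<open>a\<^sup>2\<^sup>n = b\<^sup>4 = 1\<close> already make it trivial.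
\<close>

lemma V8_iso_model:
  assumes n: "n \<ge> 1"
  shows "\<exists>h. h \<in> iso (V8 n) (V8_model n)"
proof -
  let ?M = "V8_model n"
  let ?f = "\<lambda>x. case x of Gen_a \<Rightarrow> (1, False, False) | Gen_b \<Rightarrow> (0, False, True)"
  let ?a = "word_class (V8_rels n) (gen Gen_a)" and ?b = "word_class (V8_rels n) (gen Gen_b)"
  interpret M: group ?M by (rule group_V8_model[OF n])
  have f: "?f x \<in> carrier ?M" for x
    using n by (cases x) (auto simp: V8_model_simps)
  have ev_a: "eval_word ?M ?f (gen Gen_a) = (1, False, False)"
    and ev_b: "eval_word ?M ?f (gen Gen_b) = (0, False, True)"
    using n f[of Gen_a] f[of Gen_b] by (auto simp: eval_word_def gen_def)
  have ev_a': "eval_word ?M ?f (inv_word (gen Gen_a)) = (- 1 mod (2 * int n), False, False)"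
    and ev_b': "eval_word ?M ?f (inv_word (gen Gen_b)) = (0, True, True)"
    using n f[of Gen_a] f[of Gen_b]
    by (auto simp: eval_word_def gen_def inv_word_def inv_V8_model V8_model_simps)
  have "eval_word ?M ?f u = eval_word ?M ?f v" if "(u, v) \<in> V8_rels n" for u v
    using that n
    by (auto simp: V8_rels_def Let_def eval_word_append[OF M.group_axioms f]
        eval_word_pow[OF M.group_axioms f] ev_a ev_b ev_a' ev_b' V8_model_pow_a V8_model_pow_b
        V8_model_simps mod_simps even_mod_double) (auto simp: eval_word_def V8_model_simps)
  from presented_group_universal[OF M.group_axioms f this]
  obtain h where h: "h \<in> hom (V8 n) ?M" "\<And>w. h (word_class (V8_rels n) w) = eval_word ?M ?f w"
    unfolding V8_def by blast
  interpret group_hom "V8 n" ?M h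
    using h(1) group_presented_group[of "V8_rels n"] M.group_axioms
    by (simp add: group_hom_def group_hom_axioms_def V8_def)
  have ab: "?a \<in> carrier (V8 n)" "?b \<in> carrier (V8 n)"
    by (auto simp: V8_def presented_group_simps)
  have hab: "h (?a [^]\<^bsub>V8 n\<^esub> i \<otimes>\<^bsub>V8 n\<^esub> ?b [^]\<^bsub>V8 n\<^esub> j) =
      (int i mod (2 * int n), odd (j div 2), odd j)" for i j :: nat
    using ab n
    by (simp add: hom_nat_pow h(2) ev_a ev_b V8_model_pow_a V8_model_pow_b V8_model_simps)
  have "X = \<one>\<^bsub>V8 n\<^esub>" if X: "X \<in> carrier (V8 n)" "h X = \<one>\<^bsub>?M\<^esub>" for X
  proof -
    obtain i j :: nat where ij: "X = ?a [^]\<^bsub>V8 n\<^esub> i \<otimes>\<^bsub>V8 n\<^esub> ?b [^]\<^bsub>V8 n\<^esub> j"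
      using V8_normal_form(3)[OF n X(1)] by blast
    with X(2) have i: "int i mod (2 * int n) = 0" and j: "even (j div 2)" "even j"
      by (auto simp: hab V8_model_simps)
    from i have "int (2 * n) dvd int i"
      by (simp add: dvd_eq_mod_eq_0)
    then have "2 * n dvd i"
      by (simp only: of_nat_dvd_iff)
    moreover from j have "4 dvd j"
      by presburger
    ultimately obtain i' j' where "i = 2 * n * i'" "j = 4 * j'"
      by (elim dvdE)
    then show ?thesis
      using V8_normal_form(1,2)[OF n] ab by (simp add: ij flip: G.nat_pow_pow)
  qed
  then have "inj_on h (carrier (V8 n))"
    by (auto simp: inj_on_one_iff)
  moreover have "h ` carrier (V8 n) = carrier ?M"
  proof
    show "carrier ?M \<subseteq> h ` carrier (V8 n)"
    proof
      fix x assume x: "x \<in> carrier ?M"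
      obtain i k e where ike: "x = (i, k, e)" by (cases x)
      define j :: nat where "j = 2 * of_bool k + of_bool e"
      have "int (nat i) mod (2 * int n) = i" "odd (j div 2) = k" "odd j = e"
        using x by (auto simp: ike j_def V8_model_simps)
      then have "x = h (?a [^]\<^bsub>V8 n\<^esub> nat i \<otimes>\<^bsub>V8 n\<^esub> ?b [^]\<^bsub>V8 n\<^esub> j)"
        by (simp only: hab ike)
      moreover have "?a [^]\<^bsub>V8 n\<^esub> nat i \<otimes>\<^bsub>V8 n\<^esub> ?b [^]\<^bsub>V8 n\<^esub> j \<in> carrier (V8 n)"
        using ab by simp
      ultimately show "x \<in> h ` carrier (V8 n)"
        by (rule image_eqI)
    qed
  qed (use hom_closed in blast)
  ultimately have "bij_betw h (carrier (V8 n)) (carrier ?M)"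
    by (simp only: bij_betw_def)
  with h(1) show ?thesis
    by (auto simp only: iso_def)
qed

theorem theorem2p5:
  fixes n :: nat
  assumes "n \<ge> 1"
  shows "digraph_iso (with_proj (CSCom (V8 n)))
    (with_proj
      (if even n
       then graph_join (complete_graph 4)
              (disjoint_union (complete_graph (4 * n - 4)) (graph_copies 2 (complete_graph (2 * n))))
       else graph_join (complete_graph 2)
              (disjoint_union (complete_graph (4 * n - 2)) (graph_copies 2 (complete_graph (2 * n))))))"
proof -
  let ?T = "graph_join (complete_graph (if even n then 4 else 2))
      (disjoint_union (complete_graph (4 * n - (if even n then 4 else 2)))
        (graph_copies 2 (complete_graph (2 * n))))"
  obtain h where "h \<in> iso (V8 n) (V8_model n)"
    using V8_iso_model[OF assms] by blast
  then have h: "graph_bij h (CSCom (V8 n)) (CSCom (V8_model n))"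
    by (intro graph_bij_CSCom_iso group_V8_model assms) (simp_all add: V8_def group_presented_group)
  obtain f where "graph_bij f (CSCom (V8_model n)) ?T"
    using CSCom_V8_model_structure[OF assms] by blast
  then have "graph_bij (f \<circ> h) (CSCom (V8 n)) ?T"
    by (rule graph_bij_comp[OF h])
  moreover have "parcs ?T \<subseteq> pverts ?T \<times> pverts ?T"
    by (auto simp: graph_join_def disjoint_union_def graph_copies_def complete_graph_def)
  ultimately have "digraph_iso (with_proj (CSCom (V8 n))) (with_proj ?T)"
    using parcs_CSCom_subset by (intro digraph_iso_if_graph_bij)
  then show ?thesis
    by (cases "even n") simp_all
qed

end
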